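(* Let $f(\boldsymbol{w})=f_\ell(\boldsymbol{A}\boldsymbol{w})+\phi_\lambda(\boldsymbol{w})$ be the objective function on $\mathbb{R}^n$ described in the context. Let $\boldsymbol{w}^1,\boldsymbol{w}^2,\ldots$ be the sequence generated by the DAL algorithm (with approximate inner minimization), let $W^\ast$ be the set of minimizers of $f$, let $f(W^\ast)$ be the minimum objective value, and let $\|\boldsymbol{w}-W^\ast\|:=\min_{\boldsymbol{w}^\ast\in W^\ast}\|\boldsymbol{w}-\boldsymbol{w}^\ast\|$ be the minimum distance between $\boldsymbol{w}$ and $W^\ast$. Assume: (A1) there are a positive constant $\sigma$ and a scalar $\alpha$ ($1\le\alpha\le2$) such that $f(\boldsymbol{w}^{t+1})-f(W^\ast)\ge\sigma\|\boldsymbol{w}^{t+1}-W^\ast\|^\alpha$ for $t=0,1,2,\ldots$; (A2) the loss function $f_\ell$ has a Lipschitz continuous gradient with modulus $1/\gamma$, i.e. $\|\nabla f_\ell(\boldsymbol{z})-\nabla f_\ell(\boldsymbol{z}')\|\le\frac1\gamma\|\boldsymbol{z}-\boldsymbol{z}'\|$ for all $\boldsymbol{z},\boldsymbol{z}'\in\mathbb{R}^m$; (A3) the proximation with respect to $\phi_\lambda$ (the proximity operator defined in the context) can be computed exactly; (A4) the inner minimization is solved to the tolerance $\|\nabla\varphi_t(\boldsymbol{\alpha}^t)\|\le\sqrt{\gamma/\eta_t}\,\|\boldsymbol{w}^{t+1}-\boldsymbol{w}^t\|$, where $\gamma$ is the constant in (A2). Then $$\|\boldsymbol{w}^{t+1}-W^\ast\|^2+2\sigma\eta_t\|\boldsymbol{w}^{t+1}-W^\ast\|^\alpha\le\|\boldsymbol{w}^t-W^\ast\|^2.$$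 Moreover, this implies that $$\|\boldsymbol{w}^{t+1}-W^\ast\|^{\frac{1+\alpha\sigma\eta_t}{1+2\sigma\eta_t}}\le\frac{1}{\sqrt{1+2\sigma\eta_t}}\|\boldsymbol{w}^t-W^\ast\|.$$ That is, $\boldsymbol{w}^t$ converges to $W^\ast$ super-linearly if $\alpha<2$, or if $\alpha=2$ and $\eta_t$ is increasing.
   Context: Norms are Euclidean. Problem: minimize $f(\boldsymbol{w})=f_\ell(\boldsymbol{A}\boldsymbol{w})+\phi_\lambda(\boldsymbol{w})$ over $\boldsymbol{w}\in\mathbb{R}^n$, where $\boldsymbol{A}\in\mathbb{R}^{m\times n}$ and $\lambda>0$ is a regularization constant. Standing assumptions. The loss $f_\ell:\mathbb{R}^m\to\mathbb{R}\cup\{+\infty\}$ is a closed proper strictly convex function. Its convex conjugate $f_\ell^\ast(\boldsymbol{y})=\sup_{\boldsymbol{x}}(\boldsymbol{y}^\top\boldsymbol{x}-f_\ell(\boldsymbol{x}))$ is (essentially) twice differentiable. The regularizer $\phi_\lambda$ is a closed proper convex, possibly non-differentiable function on $\mathbb{R}^n$, and $\phi_{\eta\lambda}=\eta\phi_\lambda$ for all $\eta>0$. The set $W^\ast$ of minimizers of $f$ is nonempty. Proximity operator: $\mathrm{prox}_{g}(\boldsymbol{y})=\arg\min_{\boldsymbol{x}\in\mathbb{R}^n}\left(\frac12\|\boldsymbol{y}-\boldsymbol{x}\|^2+g(\boldsymbol{x})\right)$. Moreau envelope of the conjugate $\phi_{\lambda}^\ast$ of $\phi_\lambda$: $\Phi_{\lambda}^\ast(\boldsymbol{w})=\min_{\boldsymbol{x}\in\mathbb{R}^n}\left(\phi_{\lambda}^\ast(\boldsymbol{x})+\frac12\|\boldsymbol{x}-\boldsymbol{w}\|^2\right)$.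 DAL (dual augmented Lagrangian) algorithm with approximate inner minimization. Given an initial solution $\boldsymbol{w}^0\in\mathbb{R}^n$ and a non-decreasing sequence of positive proximity parameters $\eta_0\le\eta_1\le\cdots$, at each step $t=0,1,2,\ldots$ let $\boldsymbol{\alpha}^t\in\mathbb{R}^m$ be an approximate minimizer of $$\varphi_t(\boldsymbol{\alpha})=f_\ell^\ast(-\boldsymbol{\alpha})+\frac{1}{\eta_t}\Phi_{\lambda\eta_t}^\ast(\boldsymbol{w}^t+\eta_t\boldsymbol{A}^\top\boldsymbol{\alpha})$$ (the inner minimization), and set $\boldsymbol{w}^{t+1}=\mathrm{prox}_{\phi_{\lambda\eta_t}}(\boldsymbol{w}^t+\eta_t\boldsymbol{A}^\top\boldsymbol{\alpha}^t)$. The gradient is $\nabla\varphi_t(\boldsymbol{\alpha})=-\nabla f_\ell^\ast(-\boldsymbol{\alpha})+\boldsymbol{A}\,\mathrm{prox}_{\phi_{\lambda\eta_t}}(\boldsymbol{w}^t+\eta_t\boldsymbol{A}^\top\boldsymbol{\alpha})$. (The vectors $\boldsymbol{\alpha}^t$ are unrelated to the scalar exponent $\alpha$.)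
   Formalization: For α=2, "η_t is increasing" is replaced by "η_t tends to infinity"; for bounded increasing η_t the super-linear claim fails, e.g. f_ℓ(z)=z²/2, A=1, φ=0, η_t→1 gives w^{t+1}=w^t/(1+η_t) with ratio tending to 1/2. *)

theory Defs
  imports "HOL-Analysis.Analysis"
begin

definition edom :: "('a \<Rightarrow> ereal) \<Rightarrow> 'a set" where
  "edom f = {x. f x < \<infinity>}"

definition eepigraph :: "('a \<Rightarrow> ereal) \<Rightarrow> ('a \<times> real) set" where
  "eepigraph f = {(x, r). f x \<le> ereal r}"

definition proper_fun :: "('a \<Rightarrow> ereal) \<Rightarrow> bool" where
  "proper_fun f \<longleftrightarrow> (\<forall>x. f x \<noteq> -\<infinity>) \<and> (\<exists>x. f x \<noteq> \<infinity>)"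

definition closed_proper_convex :: "('a::euclidean_space \<Rightarrow> ereal) \<Rightarrow> bool" where
  "closed_proper_convex f \<longleftrightarrow> closed (eepigraph f) \<and> proper_fun f \<and> convex (eepigraph f)"

definition strictly_convex :: "('a::euclidean_space \<Rightarrow> ereal) \<Rightarrow> bool" where
  "strictly_convex f \<longleftrightarrow> (\<forall>x \<in> edom f. \<forall>y \<in> edom f. \<forall>u. x \<noteq> y \<and> 0 < u \<and> u < 1 \<longrightarrow>
     f (u *\<^sub>R x + (1 - u) *\<^sub>R y) < ereal u * f x + ereal (1 - u) * f y)"

definition conjugate :: "('a::euclidean_space \<Rightarrow> ereal) \<Rightarrow> 'a \<Rightarrow> ereal" where
  "conjugate f y = (SUP x. ereal (y \<bullet> x) - f x)"

text \<open>A gradient is only considered at points around which the function is finite, so that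
  passing to \<^const>\<open>real_of_ereal\<close> (which sends infinite values to 0) is harmless.\<close>

definition has_egradient :: "('a::euclidean_space \<Rightarrow> ereal) \<Rightarrow> 'a \<Rightarrow> 'a \<Rightarrow> bool" where
  "has_egradient f x g \<longleftrightarrow>
     x \<in> interior {y. \<bar>f y\<bar> \<noteq> \<infinity>} \<and> GDERIV (\<lambda>y. real_of_ereal (f y)) x :> g"

text \<open>Essential smoothness in the sense of Rockafellar (differentiable on the nonempty interior
  of the effective domain, with gradients blowing up at its boundary), together with a second
  derivative on that interior.\<close>

definition essentially_twice_differentiable :: "('a::euclidean_space \<Rightarrow> ereal) \<Rightarrow> bool" where
  "essentially_twice_differentiable f \<longleftrightarrow>
     interior (edom f) \<noteq> {} \<and>
     (\<exists>G. (\<forall>x \<in> interior (edom f). has_egradient f x (G x) \<and> G differentiable (at x)) \<and>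
          (\<forall>x \<in> frontier (interior (edom f)).
             filterlim (\<lambda>y. norm (G y)) at_top (at x within interior (edom f))))"

text \<open>For closed proper convex \<open>g\<close> the minimizer is unique and the choice made by
  \<^const>\<open>arg_min\<close> is immaterial; likewise the infimum in \<open>conj_moreau\<close> is then attained.\<close>

definition prox :: "('a::euclidean_space \<Rightarrow> ereal) \<Rightarrow> 'a \<Rightarrow> 'a" where
  "prox g y = arg_min (\<lambda>x. ereal (1/2 * (norm (y - x))\<^sup>2) + g x) (\<lambda>_. True)"

definition conj_moreau :: "('a::euclidean_space \<Rightarrow> ereal) \<Rightarrow> 'a \<Rightarrow> ereal" where
  "conj_moreau g w = (INF x. conjugate g x + ereal (1/2 * (norm (x - w))\<^sup>2))"

definition objective ::
  "(real^'m \<Rightarrow> ereal) \<Rightarrow> real^'n^'m \<Rightarrow> (real^'n \<Rightarrow> ereal) \<Rightarrow> real^'n \<Rightarrow> ereal" where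
  "objective fl A g w = fl (A *v w) + g w"

definition minimizers :: "('a \<Rightarrow> ereal) \<Rightarrow> 'a set" where
  "minimizers f = {w. \<forall>v. f w \<le> f v}"

text \<open>The inner objective at a step with current iterate \<open>w\<close>, proximity parameter \<open>\<eta>\<close> and
  \<open>g\<close> the regularizer with constant \<open>lam * \<eta>\<close>.\<close>

definition dal_inner ::
  "(real^'m \<Rightarrow> ereal) \<Rightarrow> real^'n^'m \<Rightarrow> (real^'n \<Rightarrow> ereal) \<Rightarrow> real \<Rightarrow> real^'n \<Rightarrow> real^'m \<Rightarrow> ereal" where
  "dal_inner fl A g \<eta> w a =
     conjugate fl (- a) + ereal (1 / \<eta>) * conj_moreau g (w + \<eta> *\<^sub>R (transpose A *v a))"

text \<open>The outer iteration for given inner solutions \<open>a t\<close>; their accuracy is not part of this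
  definition. The proximation is exact.\<close>

definition dal_iteration ::
  "real^'n^'m \<Rightarrow> (real \<Rightarrow> real^'n \<Rightarrow> ereal) \<Rightarrow> real \<Rightarrow> (nat \<Rightarrow> real) \<Rightarrow>
   (nat \<Rightarrow> real^'m) \<Rightarrow> (nat \<Rightarrow> real^'n) \<Rightarrow> bool" where
  "dal_iteration A \<phi> lam \<eta> a w \<longleftrightarrow>
     (\<forall>t. \<eta> t > 0) \<and> mono \<eta> \<and>
     (\<forall>t. w (Suc t) = prox (\<phi> (lam * \<eta> t)) (w t + \<eta> t *\<^sub>R (transpose A *v a t)))"

text \<open>Q-superlinear convergence to a set, stated without division so that it also covers
  sequences reaching the set after finitely many steps.\<close>

definition converges_superlinearly :: "(nat \<Rightarrow> 'a::metric_space) \<Rightarrow> 'a set \<Rightarrow> bool" where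
  "converges_superlinearly w W \<longleftrightarrow>
     (\<lambda>t. infdist (w t) W) \<longlonglongrightarrow> 0 \<and>
     (\<exists>c. c \<longlonglongrightarrow> 0 \<and> (\<forall>t. infdist (w (Suc t)) W \<le> c t * infdist (w t) W))"

end

theory Submission
  imports Defs
begin

text \<open>Let \<open>p\<close> be the next iterate, \<open>d\<close> the gradient of the inner objective at the approximate
  solution \<open>a\<close>, and \<open>z = A p - d\<close>. The gradient condition says that \<open>- a\<close> is the gradient of the
  loss at \<open>z\<close>. Expanding the loss around \<open>z\<close>, from below at \<open>A x\<close> and from above (descent lemma)
  at \<open>A p\<close>, and adding the subgradient inequality of the proximal step gives
  \<open>f x \<ge> f p + (w - p) \<bullet> (x - p) / \<eta> - (norm d)\<^sup>2 / (2 * \<gamma>)\<close>. The tolerance on \<open>d\<close> turns the right-hand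
  side into \<open>f p + ((norm (x - p))\<^sup>2 - (norm (x - w))\<^sup>2) / (2 * \<eta>)\<close>; taking \<open>x\<close> in the set of
  minimizers and using the growth assumption yields the first inequality. The second one follows
  by weighted AM-GM. The affine minorant of the regularizer, needed for the proximation to exist,
  comes from first-order optimality at a minimizer of \<open>f\<close>.\<close>

section \<open>First-order optimality and the proximity operator\<close>

text \<open>The one-sided derivative at \<open>p\<close> along the segment towards \<open>x\<close>
  cannot be negative. This serves twice: for the proximal step, and for the affine minorant of the
  regularizer.\<close>

lemma minimizer_subgradient:
  fixes g :: "'a::euclidean_space \<Rightarrow> ereal"
  assumes cvx: "convex (eepigraph g)"
    and gp: "g p = ereal c"
    and min: "\<And>x. ereal (Q p) + g p \<le> ereal (Q x) + g x"
    and Q: "GDERIV Q p :> d"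
  shows "ereal (c - d \<bullet> (x - p)) \<le> g x"
proof (cases "g x")
  case (real s)
  \<comment> \<open>Here \<open>g\<close> on the segment is replaced by its chord of slope
    \<open>s - c\<close>. Up to the constant \<open>c\<close>, \<open>h\<close> dominates
    \<open>Q + g\<close>, touches it at \<open>t = 0\<close>, and is differentiable there although
    \<open>g\<close> need not be.\<close>
  define h where "h = (\<lambda>t. Q (p + t *\<^sub>R (x - p)) + t * (s - c))"
  have "((\<lambda>t::real. Q (p + t *\<^sub>R (x - p))) has_derivative (\<lambda>t. (t *\<^sub>R (x - p)) \<bullet> d)) (at 0)"
    by (rule has_derivative_compose[where f="\<lambda>t. p + t *\<^sub>R (x - p)"])
      (use Q in \<open>auto simp: gderiv_def intro!: derivative_eq_intros\<close>)
  then have h': "(h has_real_derivative (d \<bullet> (x - p) + (s - c))) (at 0)"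
    unfolding h_def has_field_derivative_def
    by (auto intro!: derivative_eq_intros simp: algebra_simps inner_commute fun_eq_iff)
  have h_ge: "h 0 \<le> h t" if t: "0 < t" "t < 1" for t
  proof -
    have "(1 - t) *\<^sub>R (p, c) + t *\<^sub>R (x, s) \<in> eepigraph g"
      using t by (intro convexD_alt[OF cvx]) (auto simp: eepigraph_def gp real)
    then have "g (p + t *\<^sub>R (x - p)) \<le> ereal (c + t * (s - c))"
      by (simp add: eepigraph_def algebra_simps)
    then have "ereal (Q p) + g p \<le> ereal (Q (p + t *\<^sub>R (x - p))) + ereal (c + t * (s - c))"
      using min[of "p + t *\<^sub>R (x - p)"] by (meson add_left_mono order_trans)
    then show ?thesis by (simp add: h_def gp)
  qed
  have "0 \<le> d \<bullet> (x - p) + (s - c)"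
  proof (rule ccontr)
    assume "\<not> ?thesis"
    then obtain e where e: "e > 0" "\<And>t. 0 < t \<Longrightarrow> t < e \<Longrightarrow> h t < h 0"
      using has_real_derivative_neg_dec_right[OF h'] by auto
    show False
      using e(2)[of "min (e/2) (1/2)"] h_ge[of "min (e/2) (1/2)"] \<open>e > 0\<close> by fastforce
  qed
  then show ?thesis by (simp add: real)
next
  case MInf
  then show ?thesis using min[of x] gp by simp
qed auto

text \<open>Existence by compactness, carried out in the epigraph: its closedness plays the role of
  lower semicontinuity, and the affine minorant bounds the sublevel set. Once a minimizer exists,
  the choice made by \<open>arg_min\<close> is one.\<close>

lemma prox_minimizes:
  fixes g :: "'a::euclidean_space \<Rightarrow> ereal"
  assumes g: "closed (eepigraph g)" "proper_fun g"
    and minorant: "\<And>x. ereal (c + b \<bullet> x) \<le> g x"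
  shows "ereal (1/2 * (norm (y - prox g y))\<^sup>2) + g (prox g y) \<le> ereal (1/2 * (norm (y - x))\<^sup>2) + g x"
    and "\<bar>g (prox g y)\<bar> \<noteq> \<infinity>"
proof -
  define q where "q = (\<lambda>x. ereal (1/2 * (norm (y - x))\<^sup>2) + g x)"
  obtain x1 s1 where x1: "g x1 = ereal s1"
    using g(2) unfolding proper_fun_def by (metis ereal_cases)
  define K where "K = 1/2 * (norm (y - x1))\<^sup>2 + s1"
  define C where "C = eepigraph g \<inter> {z. 1/2 * (norm (y - fst z))\<^sup>2 + snd z \<le> K}"
  have "closed C"
    unfolding C_def by (intro closed_Int g closed_Collect_le continuous_intros)
  moreover have "bounded C"
  proof -
    \<comment> \<open>Inserting the minorant for \<open>s\<close> and completing the square puts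
      \<open>x\<close> in a ball around \<open>y - b\<close>. \<open>R\<close> is the norm of the
      centre plus a generous radius.\<close>
    define R where "R = norm (y - b) + sqrt (2 * (K - c + (norm b)\<^sup>2 + norm y * norm b))"
    have "norm x \<le> R \<and> \<bar>s\<bar> \<le> \<bar>K\<bar> + \<bar>c\<bar> + norm b * R" if "(x, s) \<in> C" for x s
    proof -
      have xs: "g x \<le> ereal s" "1/2 * (norm (y - x))\<^sup>2 + s \<le> K"
        using that by (auto simp: C_def eepigraph_def)
      have "ereal (c + b \<bullet> x) \<le> ereal s" using minorant xs(1) by (rule order_trans)
      then have s: "c + b \<bullet> x \<le> s" by simp
      have "(norm (x - (y - b)))\<^sup>2 = (norm (y - x))\<^sup>2 + 2 * (b \<bullet> x) + (norm b)\<^sup>2 - 2 * (y \<bullet> b)"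
        unfolding power2_norm_eq_inner by (simp add: algebra_simps inner_commute)
      also have "\<dots> \<le> 2 * (K - c + (norm b)\<^sup>2 + norm y * norm b)"
        using xs(2) s abs_le_D2[OF Cauchy_Schwarz_ineq2[of y b]] zero_le_power2[of "norm b"]
        by argo
      finally have "norm (x - (y - b)) \<le> sqrt (2 * (K - c + (norm b)\<^sup>2 + norm y * norm b))"
        using real_le_rsqrt by blast
      then have R: "norm x \<le> R"
        unfolding R_def using norm_triangle_sub[of x "y - b"] by linarith
      have "\<bar>b \<bullet> x\<bar> \<le> norm b * R"
        using Cauchy_Schwarz_ineq2[of b x] R by (meson mult_left_mono norm_ge_zero order_trans)
      moreover have "s \<le> K" using xs(2) zero_le_power2[of "norm (y - x)"] by linarith
      ultimately show ?thesis using R s by linarith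
    qed
    then have "C \<subseteq> cball 0 R \<times> cball 0 (\<bar>K\<bar> + \<bar>c\<bar> + norm b * R)" by auto
    then show ?thesis by (rule bounded_subset[OF bounded_Times[OF bounded_cball bounded_cball]])
  qed
  ultimately have "compact C" by (simp add: compact_eq_bounded_closed)
  moreover have C1: "(x1, s1) \<in> C" by (simp add: C_def eepigraph_def x1 K_def)
  moreover have "continuous_on C (\<lambda>z. 1/2 * (norm (y - fst z))\<^sup>2 + snd z)"
    by (intro continuous_intros)
  ultimately obtain z where z: "z \<in> C"
    "\<forall>z'\<in>C. 1/2 * (norm (y - fst z))\<^sup>2 + snd z \<le> 1/2 * (norm (y - fst z'))\<^sup>2 + snd z'"
    using continuous_attains_inf[of C "\<lambda>z. 1/2 * (norm (y - fst z))\<^sup>2 + snd z"] by blast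
  obtain p s where "z = (p, s)" by (rule prod.exhaust)
  with z have ps: "(p, s) \<in> C"
    and pmin: "\<And>x r. (x, r) \<in> C \<Longrightarrow> 1/2 * (norm (y - p))\<^sup>2 + s \<le> 1/2 * (norm (y - x))\<^sup>2 + r"
    by fastforce+
  \<comment> \<open>\<open>s\<close> is some height above \<open>g p\<close> in the epigraph, hence
    only an inequality.\<close>
  have qp: "q p \<le> ereal (1/2 * (norm (y - p))\<^sup>2 + s)"
    using ps unfolding q_def C_def eepigraph_def
    by (cases "g p") auto
  have "q p \<le> q x" for x
  proof (cases "g x")
    case (real r)
    have "1/2 * (norm (y - p))\<^sup>2 + s \<le> 1/2 * (norm (y - x))\<^sup>2 + r"
    proof (cases "(x, r) \<in> C")
      case False
      \<comment> \<open>Points of the epigraph outside \<open>C\<close> have value above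
        \<open>K\<close>, the value at the reference point \<open>x1\<close>, which already bounds
        the minimum over \<open>C\<close>.\<close>
      then have "K < 1/2 * (norm (y - x))\<^sup>2 + r" by (auto simp: C_def eepigraph_def real)
      then show ?thesis using pmin[OF C1] by (simp add: K_def)
    qed (use pmin in auto)
    then have "ereal (1/2 * (norm (y - p))\<^sup>2 + s) \<le> q x"
      by (simp add: q_def real)
    with qp show ?thesis by (rule order_trans)
  qed (use g in \<open>auto simp: proper_fun_def q_def\<close>)
  then have "is_arg_min q (\<lambda>_. True) p" by (auto simp: is_arg_min_linorder)
  then have "is_arg_min q (\<lambda>_. True) (prox g y)"
    unfolding prox_def arg_min_def q_def[symmetric] by (rule someI)
  then have *: "q (prox g y) \<le> q x" for x by (simp add: is_arg_min_linorder)
  then show "ereal (1/2 * (norm (y - prox g y))\<^sup>2) + g (prox g y) \<le> ereal (1/2 * (norm (y - x))\<^sup>2) + g x"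
    by (simp add: q_def)
  show "\<bar>g (prox g y)\<bar> \<noteq> \<infinity>"
    using *[of x1] g(2) by (auto simp: q_def x1 proper_fun_def)
qed

lemma prox_subgradient:
  fixes g :: "'a::euclidean_space \<Rightarrow> ereal"
  assumes g: "closed_proper_convex g" and minorant: "\<And>x. ereal (c + b \<bullet> x) \<le> g x"
  obtains s where "g (prox g y) = ereal s"
    "\<And>x. ereal (s + (y - prox g y) \<bullet> (x - prox g y)) \<le> g x"
proof -
  have cl: "closed (eepigraph g)" "proper_fun g" "convex (eepigraph g)"
    using g by (auto simp: closed_proper_convex_def)
  obtain s where s: "g (prox g y) = ereal s"
    using prox_minimizes(2)[OF cl(1,2) minorant] by (metis ereal_infinity_cases not_infty_ereal)
  have "((\<lambda>x. 1/2 * ((y - x) \<bullet> (y - x))) has_derivative (\<lambda>h. h \<bullet> (prox g y - y))) (at (prox g y))"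
    by (auto intro!: derivative_eq_intros simp: inner_commute algebra_simps)
  then have "GDERIV (\<lambda>x. 1/2 * (norm (y - x))\<^sup>2) (prox g y) :> prox g y - y"
    by (simp add: gderiv_def power2_norm_eq_inner)
  from minimizer_subgradient[OF cl(3) s prox_minimizes(1)[OF cl(1,2) minorant] this]
  have "ereal (s - (prox g y - y) \<bullet> (x - prox g y)) \<le> g x" for x .
  moreover have "s - (prox g y - y) \<bullet> (x - prox g y) = s + (y - prox g y) \<bullet> (x - prox g y)" for x
    by (simp add: inner_diff_left)
  ultimately show ?thesis using that s by simp
qed

section \<open>Conjugates and the Moreau envelope\<close>

lemma conjugate_ge: "ereal (y \<bullet> x) - f x \<le> conjugate f y"
  unfolding conjugate_def by (rule SUP_upper) simp

text \<open>\<open>prox g v\<close> is the gradient of the envelope at \<open>v\<close>; the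
  subgradient inequality suffices here. It compares a lower bound that is affine in \<open>u\<close>
  with the value at the dual point \<open>v - p\<close>.\<close>

lemma conj_moreau_subgradient:
  fixes g :: "'a::euclidean_space \<Rightarrow> ereal"
  assumes g: "closed_proper_convex g" and minorant: "\<And>x. ereal (c + b \<bullet> x) \<le> g x"
  obtains m where "conj_moreau g v = ereal m"
    "\<And>u. ereal (m + prox g v \<bullet> (u - v)) \<le> conj_moreau g u"
proof -
  define p where "p = prox g v"
  obtain s where s: "g p = ereal s" and sub: "\<And>x. ereal (s + (v - p) \<bullet> (x - p)) \<le> g x"
    using prox_subgradient[OF g minorant] unfolding p_def by metis
  \<comment> \<open>Fenchel-Young at \<open>p\<close> bounds the conjugate below by
    \<open>x \<bullet> p - s\<close>; the remaining quadratic in \<open>x\<close> is smallest at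
    \<open>x = u - p\<close>.\<close>
  have lower: "ereal (u \<bullet> p - 1/2 * (p \<bullet> p) - s) \<le> conj_moreau g u" for u
    unfolding conj_moreau_def
  proof (rule INF_greatest)
    fix x
    have "x \<bullet> p - s + 1/2 * ((x - u) \<bullet> (x - u)) - (u \<bullet> p - 1/2 * (p \<bullet> p) - s)
        = 1/2 * ((x - u + p) \<bullet> (x - u + p))"
      by (simp add: algebra_simps inner_commute)
    then have "u \<bullet> p - 1/2 * (p \<bullet> p) - s \<le> x \<bullet> p - s + 1/2 * (norm (x - u))\<^sup>2"
      unfolding power2_norm_eq_inner using inner_ge_zero[of "x - u + p"] by linarith
    then have "ereal (u \<bullet> p - 1/2 * (p \<bullet> p) - s) \<le> (ereal (x \<bullet> p) - g p) + ereal (1/2 * (norm (x - u))\<^sup>2)"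
      by (simp add: s)
    also have "\<dots> \<le> conjugate g x + ereal (1/2 * (norm (x - u))\<^sup>2)"
      by (intro add_right_mono conjugate_ge)
    finally show "ereal (u \<bullet> p - 1/2 * (p \<bullet> p) - s) \<le> conjugate g x + ereal (1/2 * (norm (x - u))\<^sup>2)" .
  qed
  \<comment> \<open>As \<open>v - p\<close> is a subgradient of \<open>g\<close> at
    \<open>p\<close>, Fenchel-Young is tight there, so \<open>v - p\<close> attains the infimum
    defining the envelope at \<open>v\<close>.\<close>
  have "conjugate g (v - p) \<le> ereal ((v - p) \<bullet> p - s)"
    unfolding conjugate_def
  proof (rule SUP_least)
    fix x show "ereal ((v - p) \<bullet> x) - g x \<le> ereal ((v - p) \<bullet> p - s)"
      using sub[of x] by (cases "g x") (auto simp: algebra_simps)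
  qed
  then have "conjugate g (v - p) + ereal (1/2 * (norm (v - p - v))\<^sup>2) \<le>
      ereal ((v - p) \<bullet> p - s) + ereal (1/2 * (norm (v - p - v))\<^sup>2)"
    by (rule add_right_mono)
  also have "\<dots> = ereal (v \<bullet> p - 1/2 * (p \<bullet> p) - s)"
    by (simp add: power2_norm_eq_inner algebra_simps)
  finally have "conj_moreau g v \<le> ereal (v \<bullet> p - 1/2 * (p \<bullet> p) - s)"
    unfolding conj_moreau_def by (meson INF_lower2 UNIV_I)
  with lower[of v] have eq: "conj_moreau g v = ereal (v \<bullet> p - 1/2 * (p \<bullet> p) - s)"
    by (rule antisym[rotated])
  show ?thesis
    by (rule that[of "v \<bullet> p - 1/2 * (p \<bullet> p) - s"])
      (use eq lower in \<open>simp_all add: p_def algebra_simps inner_commute\<close>)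
qed

text \<open>Finiteness of the conjugate near \<open>y\<close> makes the superlevel sets of
  \<open>y \<bullet> x - F x\<close> bounded: tilting \<open>y\<close> by \<open>e/2\<close> in each
  coordinate direction bounds that coordinate of \<open>x\<close>.\<close>

lemma conjugate_attained:
  fixes F :: "'a::euclidean_space \<Rightarrow> real"
  assumes cont: "continuous_on UNIV F"
    and y: "y \<in> interior {y. \<bar>conjugate (\<lambda>x. ereal (F x)) y\<bar> \<noteq> \<infinity>}"
  obtains x0 where "conjugate (\<lambda>x. ereal (F x)) y = ereal (y \<bullet> x0 - F x0)"
proof -
  let ?c = "\<lambda>y. real_of_ereal (conjugate (\<lambda>x. ereal (F x)) y)"
  obtain e where e: "e > 0" "ball y e \<subseteq> {y. \<bar>conjugate (\<lambda>x. ereal (F x)) y\<bar> \<noteq> \<infinity>}"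
    using y by (meson interior_subset mem_interior)
  have le: "u \<bullet> x - F x \<le> ?c u" if "u \<in> ball y e" for u x
  proof -
    have "\<bar>conjugate (\<lambda>x. ereal (F x)) u\<bar> \<noteq> \<infinity>" using e that by auto
    then show ?thesis
      using conjugate_ge[of u x "\<lambda>x. ereal (F x)"]
      by (cases "conjugate (\<lambda>x. ereal (F x)) u") auto
  qed
  define S where "S = {x. y \<bullet> 0 - F 0 \<le> y \<bullet> x - F x}"
  define B where "B = (\<Sum>i\<in>Basis. (\<bar>?c (y + (e/2) *\<^sub>R i)\<bar> + \<bar>?c (y - (e/2) *\<^sub>R i)\<bar> + \<bar>F 0\<bar>) * (2 / e) :: real)"
  have "norm x \<le> B" if "x \<in> S" for x
  proof -
    have "\<bar>x \<bullet> i\<bar> \<le> (\<bar>?c (y + (e/2) *\<^sub>R i)\<bar> + \<bar>?c (y - (e/2) *\<^sub>R i)\<bar> + \<bar>F 0\<bar>) * (2 / e)"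
      if i: "i \<in> Basis" for i
    proof -
      \<comment> \<open>Split the tilted value into \<open>y \<bullet> x - F x\<close>, at least
        \<open>- F 0\<close> on \<open>S\<close>, and the tilt
        \<open>(e/2) * (x \<bullet> i)\<close>.\<close>
      have *: "(e/2) * (x \<bullet> i) \<le> ?c (y + (e/2) *\<^sub>R i) + F 0"
        using le[of "y + (e/2) *\<^sub>R i" x] e i \<open>x \<in> S\<close>
        by (simp add: S_def dist_norm inner_add_left inner_commute[of i])
      have "- ((e/2) * (x \<bullet> i)) \<le> ?c (y - (e/2) *\<^sub>R i) + F 0"
        using le[of "y - (e/2) *\<^sub>R i" x] e i \<open>x \<in> S\<close>
        by (simp add: S_def dist_norm inner_diff_left inner_commute[of i])
      with * have "\<bar>(e/2) * (x \<bullet> i)\<bar> \<le> \<bar>?c (y + (e/2) *\<^sub>R i)\<bar> + \<bar>?c (y - (e/2) *\<^sub>R i)\<bar> + \<bar>F 0\<bar>"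
        by linarith
      then show ?thesis using e by (simp add: abs_mult field_simps)
    qed
    then have "(\<Sum>i\<in>Basis. \<bar>x \<bullet> i\<bar>) \<le> B" unfolding B_def by (rule sum_mono)
    then show ?thesis using norm_le_l1[of x] by linarith
  qed
  then have "bounded S" by (auto simp: bounded_iff)
  moreover have "closed S"
    unfolding S_def by (intro closed_Collect_le continuous_intros cont)
  ultimately have "compact S" by (simp add: compact_eq_bounded_closed)
  moreover have "0 \<in> S" by (simp add: S_def)
  moreover have "continuous_on S (\<lambda>x. y \<bullet> x - F x)"
    by (intro continuous_intros continuous_on_subset[OF cont]) auto
  ultimately obtain x0 where "x0 \<in> S" and max: "\<And>x. x \<in> S \<Longrightarrow> y \<bullet> x - F x \<le> y \<bullet> x0 - F x0"
    using continuous_attains_sup[of S "\<lambda>x. y \<bullet> x - F x"] by blast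
  have "y \<bullet> x - F x \<le> y \<bullet> x0 - F x0" for x
    using max[of x] max[OF \<open>0 \<in> S\<close>] by (cases "x \<in> S") (auto simp: S_def)
  then have "conjugate (\<lambda>x. ereal (F x)) y \<le> ereal (y \<bullet> x0 - F x0)"
    unfolding conjugate_def by (intro SUP_least) simp
  then show ?thesis
    using that[of x0] conjugate_ge[of y x0 "\<lambda>x. ereal (F x)"] by simp
qed

section \<open>Smooth functions\<close>

text \<open>Along the segment from \<open>x\<close> to \<open>z\<close>, the difference between
  \<open>F\<close> and its quadratic model has nonpositive derivative, by Cauchy-Schwarz and the
  Lipschitz bound.\<close>

lemma descent_lemma:
  fixes F :: "'a::euclidean_space \<Rightarrow> real"
  assumes F: "\<And>z. GDERIV F z :> G z" and G: "L-lipschitz_on UNIV G"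
  shows "F z \<le> F x + G x \<bullet> (z - x) + L / 2 * (norm (z - x))\<^sup>2"
proof -
  define d where "d = z - x"
  define h where "h = (\<lambda>t. F (x + t *\<^sub>R d) - t * (G x \<bullet> d) - L / 2 * t\<^sup>2 * (norm d)\<^sup>2)"
  have h': "(h has_real_derivative ((G (x + t *\<^sub>R d) - G x) \<bullet> d - L * t * (norm d)\<^sup>2)) (at t)" for t
  proof -
    have "((\<lambda>t::real. F (x + t *\<^sub>R d)) has_derivative (\<lambda>s. (s *\<^sub>R d) \<bullet> G (x + t *\<^sub>R d))) (at t)"
      by (rule has_derivative_compose[where f="\<lambda>t. x + t *\<^sub>R d"])
        (use F in \<open>auto simp: gderiv_def intro!: derivative_eq_intros\<close>)
    then have "((\<lambda>t::real. F (x + t *\<^sub>R d)) has_real_derivative (G (x + t *\<^sub>R d) \<bullet> d)) (at t)"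
      unfolding has_field_derivative_def by (simp add: inner_commute mult_commute_abs)
    then show ?thesis
      unfolding h_def by (auto intro!: derivative_eq_intros simp: algebra_simps)
  qed
  have "h 1 \<le> h 0"
  proof (rule DERIV_nonpos_imp_nonincreasing[of 0 1 h])
    fix t :: real assume t: "0 \<le> t" "t \<le> 1"
    have "norm (G (x + t *\<^sub>R d) - G x) \<le> L * (t * norm d)"
      using lipschitz_onD[OF G, of "x + t *\<^sub>R d" x] t by (simp add: dist_norm)
    then have "(G (x + t *\<^sub>R d) - G x) \<bullet> d \<le> L * (t * norm d) * norm d"
      by (meson mult_right_mono norm_cauchy_schwarz norm_ge_zero order_trans)
    then show "\<exists>y. (h has_real_derivative y) (at t) \<and> y \<le> 0"
      using h'[of t] by (intro exI conjI) (auto simp: power2_eq_square algebra_simps)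
  qed simp
  then show ?thesis by (simp add: h_def d_def)
qed

text \<open>Subtracting the linear part leaves a local minimum, where the derivative vanishes. The
  inequality is asked only near \<open>x\<close> because the inner objective is known to be finite
  only near the inner solution.\<close>

lemma gradient_eq_subgradient:
  fixes H :: "'a::euclidean_space \<Rightarrow> real"
  assumes "GDERIV H x :> d" "eventually (\<lambda>z. H x + u \<bullet> (z - x) \<le> H z) (nhds x)"
  shows "d = u"
proof -
  have "((\<lambda>z. H z - u \<bullet> z) has_derivative (\<lambda>h. h \<bullet> d - u \<bullet> h)) (at x)"
    using assms(1) unfolding gderiv_def by (auto intro!: derivative_eq_intros)
  moreover have "\<forall>\<^sub>F z in at x. H x - u \<bullet> x \<le> H z - u \<bullet> z"
    using assms(2) unfolding eventually_at_filter
    by (auto elim!: eventually_mono simp: inner_diff_right)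
  ultimately have "(\<lambda>h. h \<bullet> d - u \<bullet> h) = (\<lambda>h. 0)"
    by (rule has_derivative_local_min)
  then have "(d - u) \<bullet> d - u \<bullet> (d - u) = 0" by metis
  then have "(d - u) \<bullet> (d - u) = 0" by (simp add: algebra_simps inner_commute)
  then show ?thesis by simp
qed

section \<open>The composite objective and one step of the algorithm\<close>

lemma inner_vector_matrix: "h \<bullet> (x v* A) = (A *v h) \<bullet> (x :: real^'m)"
  by (metis dot_lmul_matrix inner_commute)

text \<open>Optimality at \<open>v\<close> makes minus the gradient of the smooth part a subgradient
  of \<open>g\<close>. Finiteness of \<open>g v\<close> later lets optimal values be subtracted as
  reals.\<close>

lemma smooth_composite_minimizer_minorant:
  fixes F :: "real^'m \<Rightarrow> real" and A :: "real^'n^'m" and g :: "real^'n \<Rightarrow> ereal"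
  assumes g: "closed_proper_convex g" and F: "\<And>z. GDERIV F z :> G z"
    and v: "v \<in> minimizers (objective (\<lambda>z. ereal (F z)) A g)"
  obtains c b where "\<And>x. ereal (c + b \<bullet> x) \<le> g x" "\<bar>g v\<bar> \<noteq> \<infinity>"
proof -
  have le: "ereal (F (A *v v)) + g v \<le> ereal (F (A *v x)) + g x" for x
    using v by (simp add: minimizers_def objective_def)
  obtain x1 where "g x1 \<noteq> \<infinity>" "g v \<noteq> -\<infinity>"
    using g unfolding closed_proper_convex_def proper_fun_def by metis
  then obtain s where s: "g v = ereal s"
    using le[of x1] by (cases "g v") auto
  have "((\<lambda>x. F (A *v x)) has_derivative (\<lambda>h. (A *v h) \<bullet> G (A *v v))) (at v)"
    by (rule has_derivative_compose[where f="\<lambda>x. A *v x"])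
      (use F in \<open>auto simp: gderiv_def intro!: bounded_linear_imp_has_derivative matrix_vector_mul_bounded_linear\<close>)
  then have "GDERIV (\<lambda>x. F (A *v x)) v :> transpose A *v G (A *v v)"
    by (simp add: gderiv_def inner_vector_matrix)
  with g s le have "ereal (s - (transpose A *v G (A *v v)) \<bullet> (x - v)) \<le> g x" for x
    by (intro minimizer_subgradient[where Q="\<lambda>x. F (A *v x)"]) (auto simp: closed_proper_convex_def)
  then have "ereal ((s + (transpose A *v G (A *v v)) \<bullet> v) + (- (transpose A *v G (A *v v))) \<bullet> x) \<le> g x" for x
    by (simp add: algebra_simps)
  then show ?thesis by (rule that) (simp add: s)
qed

lemma closed_proper_convex_scale:
  assumes g: "closed_proper_convex g" and c: "c > 0"
  shows "closed_proper_convex (\<lambda>x. ereal c * g x)"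
proof -
  have "ereal c * g x \<le> ereal r \<longleftrightarrow> g x \<le> ereal (r / c)" for x r
    using c by (cases "g x") (auto simp: field_simps)
  then have epi: "eepigraph (\<lambda>x. ereal c * g x) = (\<lambda>z. (fst z, snd z / c)) -` eepigraph g"
    by (auto simp: eepigraph_def)
  have "linear (\<lambda>z::'a \<times> real. (fst z, snd z / c))"
    by (rule linearI) (auto simp: add_divide_distrib)
  then have "convex (eepigraph (\<lambda>x. ereal c * g x))"
    using g unfolding epi closed_proper_convex_def by (blast intro: convex_linear_vimage)
  moreover have "closed (eepigraph (\<lambda>x. ereal c * g x))"
    using g c unfolding epi closed_proper_convex_def
    by (intro closed_vimage) (auto intro!: continuous_intros)
  moreover have "proper_fun (\<lambda>x. ereal c * g x)"
    using g c unfolding closed_proper_convex_def proper_fun_def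
    by (auto simp: ereal_mult_eq_MInfty ereal_mult_eq_PInfty)
  ultimately show ?thesis by (simp add: closed_proper_convex_def)
qed

text \<open>The gradient condition forces \<open>A p - d\<close> to be a maximizer in the conjugate at \<open>-a\<close>,
  because both summands of the inner objective have a subgradient there.\<close>

lemma dal_inner_gradient:
  fixes F :: "real^'m \<Rightarrow> real" and A :: "real^'n^'m" and g :: "real^'n \<Rightarrow> ereal"
  assumes cont: "continuous_on UNIV F" and g: "closed_proper_convex g"
    and minorant: "\<And>x. ereal (c + b \<bullet> x) \<le> g x" and \<eta>: "\<eta> > 0"
    and grad: "has_egradient (dal_inner (\<lambda>z. ereal (F z)) A g \<eta> w) a d"
  defines "p \<equiv> prox g (w + \<eta> *\<^sub>R (transpose A *v a))"
  defines "z \<equiv> A *v p - d"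
  shows "F z - a \<bullet> (x - z) \<le> F x"
proof -
  let ?H = "dal_inner (\<lambda>z. ereal (F z)) A g \<eta> w"
  let ?f = "\<lambda>z. ereal (F z)"
  let ?v = "\<lambda>u. w + \<eta> *\<^sub>R (transpose A *v u)"
  \<comment> \<open>The envelope is finite everywhere, so finiteness of the inner objective passes
    to the conjugate.\<close>
  have fin: "\<bar>conjugate ?f (-u)\<bar> \<noteq> \<infinity>" if "\<bar>?H u\<bar> \<noteq> \<infinity>" for u
  proof -
    obtain m where "conj_moreau g (?v u) = ereal m"
      using conj_moreau_subgradient[OF g minorant] by metis
    with that show ?thesis by (cases "conjugate ?f (-u)") (auto simp: dal_inner_def)
  qed
  have int: "a \<in> interior {u. \<bar>?H u\<bar> \<noteq> \<infinity>}"
    and gd: "GDERIV (\<lambda>u. real_of_ereal (?H u)) a :> d"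
    using grad by (auto simp: has_egradient_def)
  have "-a \<in> interior (uminus ` {u. \<bar>?H u\<bar> \<noteq> \<infinity>})"
    using int by (simp add: interior_negations)
  moreover have "uminus ` {u. \<bar>?H u\<bar> \<noteq> \<infinity>} \<subseteq> {y. \<bar>conjugate ?f y\<bar> \<noteq> \<infinity>}"
    by (intro image_subsetI CollectI fin) simp
  ultimately have "-a \<in> interior {y. \<bar>conjugate ?f y\<bar> \<noteq> \<infinity>}"
    using interior_mono by blast
  from conjugate_attained[OF cont this]
  obtain x0 where x0: "conjugate ?f (-a) = ereal (- a \<bullet> x0 - F x0)" .
  obtain m where m: "conj_moreau g (?v a) = ereal m"
    "\<And>u. ereal (m + p \<bullet> (u - ?v a)) \<le> conj_moreau g u"
    unfolding p_def using conj_moreau_subgradient[OF g minorant, of "?v a"] by blast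
  have Ha: "?H a = ereal (- a \<bullet> x0 - F x0 + m / \<eta>)"
    unfolding dal_inner_def x0 m by simp
  \<comment> \<open>The maximizer \<open>x0\<close> contributes slope \<open>- x0\<close> by
    Fenchel-Young, the envelope contributes \<open>A *v p\<close>: the factor \<open>\<eta>\<close>
    from its argument cancels the weight \<open>1 / \<eta>\<close>.\<close>
  have sub: "?H a + ereal ((A *v p - x0) \<bullet> (u - a)) \<le> ?H u" for u
  proof -
    have eq: "p \<bullet> (?v u - ?v a) = \<eta> * ((A *v p) \<bullet> (u - a))"
      by (simp add: inner_diff_right inner_add_right inner_vector_matrix right_diff_distrib)
    have sub: "?H a + ereal ((A *v p - x0) \<bullet> (u - a))
        = (ereal (- u \<bullet> x0) - ?f x0) + ereal (1 / \<eta>) * ereal (m + p \<bullet> (?v u - ?v a))"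
      unfolding eq Ha using \<eta>
      by (simp add: add_divide_distrib) (simp add: algebra_simps inner_commute)
    also have "\<dots> \<le> ?H u"
      unfolding dal_inner_def
      by (intro add_mono conjugate_ge ereal_mult_left_mono m) (use \<eta> in auto)
    finally show ?thesis .
  qed
  have "\<forall>\<^sub>F u in nhds a. \<bar>?H u\<bar> \<noteq> \<infinity>"
    using eventually_nhds_in_nhd[OF int] by simp
  then have "\<forall>\<^sub>F u in nhds a.
      real_of_ereal (?H a) + (A *v p - x0) \<bullet> (u - a) \<le> real_of_ereal (?H u)"
  proof (rule eventually_mono)
    fix u assume "\<bar>?H u\<bar> \<noteq> \<infinity>"
    then show "real_of_ereal (?H a) + (A *v p - x0) \<bullet> (u - a) \<le> real_of_ereal (?H u)"
      using sub[of u] by (cases "?H u") (simp_all add: Ha)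
  qed
  with gd have "d = A *v p - x0" by (rule gradient_eq_subgradient)
  then have z: "z = x0" by (simp add: z_def)
  have "ereal (- a \<bullet> x) - ?f x \<le> ereal (- a \<bullet> x0 - F x0)"
    using conjugate_ge[of "-a" x ?f] by (simp add: x0)
  then show ?thesis by (simp add: z algebra_simps)
qed

text \<open>The comparison point \<open>x\<close> stays arbitrary. The inexactness costs
  \<open>(norm d)\<^sup>2 / (2 * \<gamma>)\<close>, and the tolerance is scaled so that the
  quadratic gain of the proximal step pays for it.\<close>

lemma dal_step:
  fixes F :: "real^'m \<Rightarrow> real" and A :: "real^'n^'m" and g :: "real^'n \<Rightarrow> ereal"
  assumes F: "\<And>z. GDERIV F z :> G z" "(1 / \<gamma>)-lipschitz_on UNIV G" and \<gamma>: "\<gamma> > 0"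
    and g: "closed_proper_convex g"
    and minorant: "\<And>x. ereal (c + b \<bullet> x) \<le> g x" and \<eta>: "\<eta> > 0"
    and p: "p = prox (\<lambda>x. ereal \<eta> * g x) (w + \<eta> *\<^sub>R (transpose A *v a))"
    and grad: "has_egradient (dal_inner (\<lambda>z. ereal (F z)) A (\<lambda>x. ereal \<eta> * g x) \<eta> w) a d"
    and d: "norm d \<le> sqrt (\<gamma> / \<eta>) * norm (p - w)"
  obtains s where "g p = ereal s"
    "\<And>x. ereal (F (A *v p) + s + ((norm (x - p))\<^sup>2 - (norm (x - w))\<^sup>2) / (2 * \<eta>))
      \<le> ereal (F (A *v x)) + g x"
proof -
  let ?h = "\<lambda>x. ereal \<eta> * g x"
  let ?y = "w + \<eta> *\<^sub>R (transpose A *v a)"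
  have h: "closed_proper_convex ?h" using g \<eta> by (rule closed_proper_convex_scale)
  have hm: "ereal (\<eta> * c + (\<eta> *\<^sub>R b) \<bullet> x) \<le> ?h x" for x
    using ereal_mult_left_mono[OF minorant[of x], of "ereal \<eta>"] \<eta> by (simp add: algebra_simps)
  obtain s' where s': "?h p = ereal s'" and sub: "\<And>x. ereal (s' + (?y - p) \<bullet> (x - p)) \<le> ?h x"
    using prox_subgradient[OF h hm] unfolding p by metis
  obtain s where s: "g p = ereal s" and s's: "s' = \<eta> * s"
    using s' \<eta> by (cases "g p") auto
  have cont: "continuous_on UNIV F"
    using F(1) unfolding gderiv_def
    by (blast intro: continuous_at_imp_continuous_on has_derivative_continuous)
  define z where "z = A *v p - d"
  have zsub: "F z - a \<bullet> (x - z) \<le> F x" for x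
    unfolding z_def p using dal_inner_gradient[OF cont h hm \<eta> grad] .
  have Gz: "G z = - a"
    by (rule gradient_eq_subgradient[OF F(1)]) (use zsub in auto)
  have dd: "(norm d)\<^sup>2 / \<gamma> \<le> (norm (p - w))\<^sup>2 / \<eta>"
  proof -
    have "(norm d)\<^sup>2 \<le> (sqrt (\<gamma> / \<eta>) * norm (p - w))\<^sup>2"
      using d by (intro power_mono) auto
    then show ?thesis using \<gamma> \<eta> by (simp add: power_mult_distrib field_simps)
  qed
  \<comment> \<open>The lower expansion at \<open>A *v x\<close> and the upper one at
    \<open>A *v p\<close> share the base point \<open>z\<close>, which cancels.\<close>
  have Fp: "F (A *v p) \<le> F (A *v x) + (transpose A *v a) \<bullet> (x - p) + (norm (p - w))\<^sup>2 / (2 * \<eta>)" for x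
  proof -
    have "F (A *v p) \<le> F z - a \<bullet> (A *v p - z) + 1 / \<gamma> / 2 * (norm (A *v p - z))\<^sup>2"
      using descent_lemma[OF F, of "A *v p" z] by (simp add: Gz)
    moreover have "1 / \<gamma> / 2 * (norm (A *v p - z))\<^sup>2 \<le> (norm (p - w))\<^sup>2 / (2 * \<eta>)"
      using dd by (simp add: z_def)
    moreover have "F z - a \<bullet> (A *v x - z) \<le> F (A *v x)" by (rule zsub)
    moreover have "(transpose A *v a) \<bullet> (x - p) = a \<bullet> (A *v x - z) - a \<bullet> (A *v p - z)"
      by (simp add: inner_diff_right dot_lmul_matrix matrix_vector_mult_diff_distrib)
    ultimately show ?thesis by linarith
  qed
  have "ereal (F (A *v p) + s + ((norm (x - p))\<^sup>2 - (norm (x - w))\<^sup>2) / (2 * \<eta>))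
      \<le> ereal (F (A *v x)) + g x" for x
  proof (cases "g x")
    case (real r)
    have "\<eta> * s + (?y - p) \<bullet> (x - p) \<le> \<eta> * r"
      using sub[of x] by (simp add: real s's)
    then have "s + ((w - p) \<bullet> (x - p)) / \<eta> + (transpose A *v a) \<bullet> (x - p) \<le> r"
      using \<eta> by (simp add: inner_add_left inner_diff_left field_simps)
    \<comment> \<open>Three-point identity: the term \<open>(norm (p - w))\<^sup>2\<close> it
      produces is exactly the one allowed to the inner error.\<close>
    moreover have "((w - p) \<bullet> (x - p)) / \<eta> - (norm (p - w))\<^sup>2 / (2 * \<eta>)
        = ((norm (x - p))\<^sup>2 - (norm (x - w))\<^sup>2) / (2 * \<eta>)"
      using \<eta> unfolding power2_norm_eq_inner by (simp add: field_simps inner_commute algebra_simps)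
    ultimately show ?thesis using Fp[of x] by (simp add: real)
  next
    case MInf
    then show ?thesis using minorant[of x] by simp
  qed simp
  with s show ?thesis by (rule that)
qed

section \<open>Real inequalities and rates of convergence\<close>

text \<open>Young's inequality with weights \<open>1 / (1 + k)\<close> and
  \<open>k / (1 + k)\<close>. At \<open>x = 0\<close> both sides vanish, since
  \<open>0 powr y = 0\<close> for every \<open>y\<close>.\<close>

lemma weighted_am_gm_powr:
  fixes x k \<alpha> :: real
  assumes "x \<ge> 0" "k > 0"
  shows "(1 + k) * (x powr ((2 + \<alpha> * k) / (1 + k))) \<le> x\<^sup>2 + k * x powr \<alpha>"
proof (cases "x = 0")
  case False
  have "1 / (1 + k) + k / (1 + k) = 1" using assms by (simp add: field_simps)
  then have "(x\<^sup>2) powr (1 / (1 + k)) * (x powr \<alpha>) powr (k / (1 + k))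
      \<le> 1 / (1 + k) * x\<^sup>2 + k / (1 + k) * x powr \<alpha>"
    using False assms by (intro Youngs_inequality_0) auto
  moreover have "x\<^sup>2 = x powr 2" using False assms by simp
  then have "(x\<^sup>2) powr (1 / (1 + k)) * (x powr \<alpha>) powr (k / (1 + k)) = x powr ((2 + \<alpha> * k) / (1 + k))"
    by (simp add: powr_powr powr_add[symmetric] add_divide_distrib)
  ultimately have "(1 + k) * x powr ((2 + \<alpha> * k) / (1 + k))
      \<le> (1 + k) * (1 / (1 + k) * x\<^sup>2 + k / (1 + k) * x powr \<alpha>)"
    using assms by (intro mult_left_mono) auto
  also have "\<dots> = x\<^sup>2 + k * x powr \<alpha>" using assms by (simp add: distrib_left)
  finally show ?thesis .
qed simp

text \<open>The squares decrease and hence converge, so their successive differences tend to 0 and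
  force \<open>D\<close> to 0. The rate comes from the power term if \<open>\<alpha> < 2\<close>,
  and from the growth of \<open>\<eta>\<close> if \<open>\<alpha> = 2\<close>.\<close>

lemma superlinear_of_recurrence:
  fixes D \<eta> :: "nat \<Rightarrow> real"
  assumes D: "\<And>t. 0 \<le> D t" and \<sigma>: "\<sigma> > 0" and \<alpha>: "1 \<le> \<alpha>" "\<alpha> \<le> 2"
    and \<eta>: "\<And>t. 0 < \<eta> t" "mono \<eta>"
    and rec: "\<And>t. (D (Suc t))\<^sup>2 + 2 * \<sigma> * \<eta> t * D (Suc t) powr \<alpha> \<le> (D t)\<^sup>2"
    and fast: "\<alpha> < 2 \<or> filterlim \<eta> at_top sequentially"
  shows "D \<longlonglongrightarrow> 0" "\<exists>c. c \<longlonglongrightarrow> 0 \<and> (\<forall>t. D (Suc t) \<le> c t * D t)"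
proof -
  \<comment> \<open>By monotonicity \<open>\<eta> 0\<close> bounds all parameters below, giving a
    factor independent of \<open>t\<close>.\<close>
  define K where "K = 2 * \<sigma> * \<eta> 0"
  have K: "K > 0" using \<sigma> \<eta>(1) by (simp add: K_def)
  have recK: "K * D (Suc t) powr \<alpha> \<le> (D t)\<^sup>2 - (D (Suc t))\<^sup>2" for t
  proof -
    have "K * D (Suc t) powr \<alpha> \<le> 2 * \<sigma> * \<eta> t * D (Suc t) powr \<alpha>"
      unfolding K_def using \<sigma> monoD[OF \<eta>(2), of 0 t] by (intro mult_right_mono) auto
    then show ?thesis using rec[of t] by linarith
  qed
  have "decseq (\<lambda>t. (D t)\<^sup>2)"
    using recK K by (intro decseq_SucI) (meson diff_ge_0_iff_ge mult_nonneg_nonneg less_imp_le order_trans powr_ge_zero)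
  then have "convergent (\<lambda>t. (D t)\<^sup>2)"
    by (intro Bseq_monoseq_convergent decseq_imp_monoseq decseq_bounded[where B=0]) auto
  then obtain l where "(\<lambda>t. (D t)\<^sup>2) \<longlonglongrightarrow> l" by (auto simp: convergent_def)
  then have "(\<lambda>t. ((D t)\<^sup>2 - (D (Suc t))\<^sup>2) / K) \<longlonglongrightarrow> (l - l) / K"
    using K by (intro tendsto_divide tendsto_diff tendsto_const LIMSEQ_Suc[of "\<lambda>t. (D t)\<^sup>2"]) auto
  then have lim0: "(\<lambda>t. ((D t)\<^sup>2 - (D (Suc t))\<^sup>2) / K) \<longlonglongrightarrow> 0" by simp
  have "D (Suc t) powr \<alpha> \<le> ((D t)\<^sup>2 - (D (Suc t))\<^sup>2) / K" for t
    using recK[of t] K by (simp add: pos_le_divide_eq mult.commute)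
  then have "(\<lambda>t. D (Suc t) powr \<alpha>) \<longlonglongrightarrow> 0"
    by (intro tendsto_sandwich[OF _ _ tendsto_const lim0] always_eventually allI powr_ge_zero)
  then have "(\<lambda>t. (D (Suc t) powr \<alpha>) powr (1 / \<alpha>)) \<longlonglongrightarrow> 0 powr (1 / \<alpha>)"
    using \<alpha> by (intro tendsto_powr') auto
  then have "(\<lambda>t. D (Suc t)) \<longlonglongrightarrow> 0"
    using \<alpha> D by (simp add: powr_powr)
  then show D0: "D \<longlonglongrightarrow> 0" by (rule LIMSEQ_imp_Suc)
  show "\<exists>c. c \<longlonglongrightarrow> 0 \<and> (\<forall>t. D (Suc t) \<le> c t * D t)"
  proof (cases "\<alpha> < 2")
    case True
    \<comment> \<open>Take the \<open>\<alpha>\<close>-th root of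
      \<open>D (Suc t) powr \<alpha> \<le> (D t)\<^sup>2 / K\<close> and split off one factor
      \<open>D t\<close>; the remaining exponent \<open>2 / \<alpha> - 1\<close> is positive because
      \<open>\<alpha> < 2\<close>.\<close>
    define c where "c = (\<lambda>t. (1 / K) powr (1 / \<alpha>) * D t powr (2 / \<alpha> - 1))"
    have "c \<longlonglongrightarrow> (1 / K) powr (1 / \<alpha>) * 0 powr (2 / \<alpha> - 1)"
      unfolding c_def using \<alpha> True D D0 by (intro tendsto_intros tendsto_powr') auto
    then have "c \<longlonglongrightarrow> 0" by simp
    moreover have "D (Suc t) \<le> c t * D t" for t
    proof -
      have "D (Suc t) powr \<alpha> \<le> 1 / K * (D t)\<^sup>2"
        using order_trans[OF recK[of t], of "(D t)\<^sup>2"] K by (simp add: field_simps)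
      then have "(D (Suc t) powr \<alpha>) powr (1 / \<alpha>) \<le> (1 / K * (D t)\<^sup>2) powr (1 / \<alpha>)"
        using \<alpha> by (intro powr_mono2) auto
      also have "\<dots> = (1 / K) powr (1 / \<alpha>) * ((D t)\<^sup>2) powr (1 / \<alpha>)"
        using K by (intro powr_mult)
      also have "((D t)\<^sup>2) powr (1 / \<alpha>) = D t powr (2 / \<alpha> - 1) * D t"
      proof (cases "D t = 0")
        case False
        then have "D t > 0" using D[of t] by simp
        moreover from this have "(D t)\<^sup>2 = D t powr 2" by simp
        ultimately show ?thesis by (simp only: powr_powr powr_diff powr_one) simp
      qed (use \<alpha> in simp)
      finally show ?thesis using \<alpha> D by (simp add: powr_powr c_def mult_ac)
    qed
    ultimately show ?thesis by blast
  next
    case False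
    then have \<alpha>2: "\<alpha> = 2" and lim: "filterlim \<eta> at_top sequentially" using \<alpha> fast by auto
    define c where "c = (\<lambda>t. inverse (sqrt (1 + 2 * \<sigma> * \<eta> t)))"
    have "filterlim (\<lambda>t. 1 + 2 * \<sigma> * \<eta> t) at_top sequentially"
      using \<sigma> by (intro filterlim_tendsto_add_at_top[OF tendsto_const]
          filterlim_tendsto_pos_mult_at_top[OF tendsto_const] lim) auto
    then have "c \<longlonglongrightarrow> 0"
      unfolding c_def
      by (intro tendsto_inverse_0_at_top filterlim_compose[OF sqrt_at_top])
    moreover have "D (Suc t) \<le> c t * D t" for t
    proof -
      have pos: "1 + 2 * \<sigma> * \<eta> t > 0" using \<sigma> \<eta>(1)[of t] by (simp add: add_pos_pos)
      have "(1 + 2 * \<sigma> * \<eta> t) * (D (Suc t))\<^sup>2 \<le> (D t)\<^sup>2"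
        using rec[of t] D[of "Suc t"] by (simp add: \<alpha>2 algebra_simps)
      then have "sqrt ((1 + 2 * \<sigma> * \<eta> t) * (D (Suc t))\<^sup>2) \<le> D t"
        using D[of t] by (intro real_le_lsqrt) auto
      then have "sqrt (1 + 2 * \<sigma> * \<eta> t) * D (Suc t) \<le> D t"
        using D by (simp only: real_sqrt_mult real_sqrt_abs abs_of_nonneg)
      then have "D (Suc t) \<le> D t / sqrt (1 + 2 * \<sigma> * \<eta> t)"
        using pos by (simp add: pos_le_divide_eq mult.commute)
      then show ?thesis by (simp only: c_def divide_inverse mult.commute)
    qed
    ultimately show ?thesis by blast
  qed
qed

section \<open>From function values to distances from the set of minimizers\<close>

text \<open>For \<open>\<alpha> = 2\<close>, increasing parameters are read as tending to infinity:
  with bounded \<open>\<eta>\<close> the contraction factors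
  \<open>1 / sqrt (1 + 2 * \<sigma> * \<eta> t)\<close> stay away from 0.\<close>

theorem theorem5:
  fixes fl :: "real^'m \<Rightarrow> ereal" and A :: "real^'n^'m"
    and \<phi> :: "real \<Rightarrow> real^'n \<Rightarrow> ereal" and lam \<gamma> \<sigma> \<alpha> :: real
    and \<eta> :: "nat \<Rightarrow> real" and a :: "nat \<Rightarrow> real^'m" and w :: "nat \<Rightarrow> real^'n"
    and f :: "real^'n \<Rightarrow> ereal" and W :: "(real^'n) set"
  defines "f \<equiv> objective fl A (\<phi> lam)" and "W \<equiv> minimizers f"
  assumes lam_pos: "lam > 0"
    and loss: "closed_proper_convex fl" "strictly_convex fl"
    and conj_loss: "essentially_twice_differentiable (conjugate fl)"
    and reg: "closed_proper_convex (\<phi> lam)"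
    and reg_scale: "\<And>c v. c > 0 \<Longrightarrow> \<phi> (c * lam) v = ereal c * \<phi> lam v"
    and W_nonempty: "W \<noteq> {}"
    and dal: "dal_iteration A \<phi> lam \<eta> a w"
    and A1: "\<sigma> > 0" "1 \<le> \<alpha>" "\<alpha> \<le> 2"
      "\<And>t. f (w (Suc t)) - (INF v. f v) \<ge> ereal (\<sigma> * infdist (w (Suc t)) W powr \<alpha>)"
    and A2: "\<gamma> > 0"
      "\<exists>G. (\<forall>z. has_egradient fl z (G z)) \<and> (1 / \<gamma>)-lipschitz_on UNIV G"
    and A4: "\<And>t. \<exists>g. has_egradient (dal_inner fl A (\<phi> (lam * \<eta> t)) (\<eta> t) (w t)) (a t) g \<and>
      norm g \<le> sqrt (\<gamma> / \<eta> t) * norm (w (Suc t) - w t)"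
  shows "(\<forall>t. (infdist (w (Suc t)) W)\<^sup>2 + 2 * \<sigma> * \<eta> t * infdist (w (Suc t)) W powr \<alpha>
              \<le> (infdist (w t) W)\<^sup>2) \<and>
    (\<forall>t. infdist (w (Suc t)) W powr ((1 + \<alpha> * \<sigma> * \<eta> t) / (1 + 2 * \<sigma> * \<eta> t))
              \<le> 1 / sqrt (1 + 2 * \<sigma> * \<eta> t) * infdist (w t) W) \<and>
    (\<alpha> < 2 \<or> (\<alpha> = 2 \<and> filterlim \<eta> at_top sequentially) \<longrightarrow> converges_superlinearly w W)"
proof -
  let ?D = "\<lambda>t. infdist (w t) W"
  obtain G where G: "\<And>z. has_egradient fl z (G z)" "(1 / \<gamma>)-lipschitz_on UNIV G"
    using A2(2) by auto
  define F where "F = (\<lambda>z. real_of_ereal (fl z))"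
  \<comment> \<open>A gradient at every point forces the loss to be finite everywhere, so it may be
    replaced by the real function \<open>F\<close>.\<close>
  have "z \<in> interior {y. \<bar>fl y\<bar> \<noteq> \<infinity>}" for z
    using G(1)[of z] by (simp add: has_egradient_def)
  then have "\<bar>fl z\<bar> \<noteq> \<infinity>" for z
    using subsetD[OF interior_subset, of z "{y. \<bar>fl y\<bar> \<noteq> \<infinity>}"] by simp
  then have fl: "fl = (\<lambda>z. ereal (F z))" by (intro ext) (simp add: F_def ereal_real')
  have F: "GDERIV F z :> G z" for z using G(1)[of z] by (simp add: has_egradient_def F_def)
  have \<eta>: "\<eta> t > 0" "mono \<eta>"
    and w: "w (Suc t) = prox (\<phi> (lam * \<eta> t)) (w t + \<eta> t *\<^sub>R (transpose A *v a t))" for t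
    using dal by (auto simp: dal_iteration_def)
  have scale: "\<phi> (lam * \<eta> t) = (\<lambda>x. ereal (\<eta> t) * \<phi> lam x)" for t
    using reg_scale[OF \<eta>(1)] by (auto simp: mult.commute)
  have f: "f x = ereal (F (A *v x)) + \<phi> lam x" for x by (simp add: f_def objective_def fl)
  obtain v0 where v0: "v0 \<in> minimizers (objective (\<lambda>z. ereal (F z)) A (\<phi> lam))"
    using W_nonempty by (auto simp: W_def f_def fl)
  obtain c b where minorant: "\<And>x. ereal (c + b \<bullet> x) \<le> \<phi> lam x"
    using smooth_composite_minimizer_minorant[OF reg F v0] by blast
  have dist_le: "(?D (Suc t))\<^sup>2 + 2 * \<sigma> * \<eta> t * ?D (Suc t) powr \<alpha> \<le> (norm (v - w t))\<^sup>2"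
    if v: "v \<in> W" for v t
  proof -
    obtain d where d: "has_egradient (dal_inner fl A (\<phi> (lam * \<eta> t)) (\<eta> t) (w t)) (a t) d"
      "norm d \<le> sqrt (\<gamma> / \<eta> t) * norm (w (Suc t) - w t)" using A4 by blast
    obtain s where s: "\<phi> lam (w (Suc t)) = ereal s"
      "\<And>x. ereal (F (A *v w (Suc t)) + s + ((norm (x - w (Suc t)))\<^sup>2 - (norm (x - w t))\<^sup>2) / (2 * \<eta> t))
        \<le> ereal (F (A *v x)) + \<phi> lam x"
      using dal_step[OF F G(2) A2(1) reg minorant \<eta>(1) w[unfolded scale] d(1)[unfolded scale fl] d(2)]
      by blast
    have vmin: "f v \<le> f x" for x using v by (simp add: W_def minimizers_def)
    have INF: "(INF x. f x) = f v"
      by (rule antisym) (auto intro: INF_lower INF_greatest vmin)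
    have "v \<in> minimizers (objective (\<lambda>z. ereal (F z)) A (\<phi> lam))"
      using v by (simp add: W_def f_def fl)
    then have "\<bar>\<phi> lam v\<bar> \<noteq> \<infinity>"
      by (rule smooth_composite_minimizer_minorant[OF reg F])
    then obtain r where r: "\<phi> lam v = ereal r" by auto
    have "\<sigma> * ?D (Suc t) powr \<alpha> \<le> F (A *v w (Suc t)) + s - (F (A *v v) + r)"
      using A1(4)[of t] unfolding INF by (simp add: f s r)
    also have "\<dots> \<le> ((norm (v - w t))\<^sup>2 - (norm (v - w (Suc t)))\<^sup>2) / (2 * \<eta> t)"
      using s(2)[of v] by (simp add: r diff_divide_distrib)
    finally have "(norm (v - w (Suc t)))\<^sup>2 + 2 * \<sigma> * \<eta> t * ?D (Suc t) powr \<alpha> \<le> (norm (v - w t))\<^sup>2"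
      using \<eta>(1)[of t] by (simp add: field_simps)
    moreover have "(?D (Suc t))\<^sup>2 \<le> (norm (v - w (Suc t)))\<^sup>2"
      using infdist_le[OF v, of "w (Suc t)"]
      by (intro power_mono) (auto simp: dist_norm norm_minus_commute infdist_nonneg)
    ultimately show ?thesis by linarith
  qed
  have rec: "(?D (Suc t))\<^sup>2 + 2 * \<sigma> * \<eta> t * ?D (Suc t) powr \<alpha> \<le> (?D t)\<^sup>2" for t
  proof -
    \<comment> \<open>The bound holds for each minimizer \<open>v\<close>. The root is taken before
      the infimum over \<open>v\<close>, because \<open>infdist\<close> is an infimum of distances,
      not of squares.\<close>
    have "sqrt ((?D (Suc t))\<^sup>2 + 2 * \<sigma> * \<eta> t * ?D (Suc t) powr \<alpha>) \<le> ?D t"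
      unfolding infdist_notempty[OF W_nonempty, of "w t"]
      using dist_le by (intro cINF_greatest W_nonempty real_le_lsqrt)
        (auto simp: dist_norm norm_minus_commute)
    then show ?thesis by (rule sqrt_le_D)
  qed
  moreover have "?D (Suc t) powr ((1 + \<alpha> * \<sigma> * \<eta> t) / (1 + 2 * \<sigma> * \<eta> t))
      \<le> 1 / sqrt (1 + 2 * \<sigma> * \<eta> t) * ?D t" for t
  proof -
    define k where "k = 2 * \<sigma> * \<eta> t"
    have k: "k > 0" using A1(1) \<eta>(1)[of t] by (simp add: k_def)
    let ?e = "(1 + \<alpha> * \<sigma> * \<eta> t) / (1 + k)"
    \<comment> \<open>With \<open>k = 2 * \<sigma> * \<eta> t\<close>, twice the exponent
      \<open>?e\<close> is the one in the weighted mean inequality.\<close>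
    have "(?D (Suc t) powr ?e)\<^sup>2 = ?D (Suc t) powr ((2 + \<alpha> * k) / (1 + k))"
      by (simp add: power2_eq_square powr_add[symmetric] add_divide_distrib[symmetric] k_def algebra_simps)
    then have "(1 + k) * (?D (Suc t) powr ?e)\<^sup>2 \<le> (?D t)\<^sup>2"
      using weighted_am_gm_powr[OF infdist_nonneg k, of "w (Suc t)" W \<alpha>] rec[of t] by (simp add: k_def)
    then have "sqrt ((1 + k) * (?D (Suc t) powr ?e)\<^sup>2) \<le> ?D t"
      by (intro real_le_lsqrt) (auto simp: infdist_nonneg)
    then have "sqrt (1 + k) * (?D (Suc t) powr ?e) \<le> ?D t"
      by (simp only: real_sqrt_mult real_sqrt_abs abs_of_nonneg powr_ge_zero)
    then have "?D (Suc t) powr ?e \<le> 1 / sqrt (1 + k) * ?D t"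
      using k by (simp add: pos_le_divide_eq mult.commute)
    then show ?thesis by (simp add: k_def)
  qed
  moreover have "converges_superlinearly w W"
    if "\<alpha> < 2 \<or> (\<alpha> = 2 \<and> filterlim \<eta> at_top sequentially)"
    using superlinear_of_recurrence[OF infdist_nonneg A1(1-3) \<eta> rec] that
    unfolding converges_superlinearly_def by blast
  ultimately show ?thesis by blast
qed

end
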